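(* There is $\Lambda_0>0$ such that if $L\in(0,\Lambda_0)$, then there exists a unique solution $u$ to $$\begin{cases} -u_{xx}+(u+c_0)^3-(u+c_0)+\zeta(x)=0, & x\in(0,L),\\ u(0)=u_x(L)=0.\end{cases}$$
   Context: $c_0\in\mathbb R$ is a fixed constant and $\zeta$ is a fixed (independent of $L$) real-analytic function with values in $(-1,0)$ on an open interval containing $[0,\infty)$. *)

theory Defs
  imports "HOL-Analysis.Analysis"
begin

definition real_analytic_on :: "(real \<Rightarrow> real) \<Rightarrow> real set \<Rightarrow> bool" where
  "real_analytic_on f S \<longleftrightarrow> (\<forall>x\<in>S. \<exists>F. (\<lambda>h. f (x + h)) has_fps_expansion F)"

(* Classical solutions, of class C^2 on (0,L) and C^1 on [0,L]. The derivatives u', u'' are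
   determined by u on these sets when L > 0; at the end points u' is the one-sided derivative.
   The predicate depends only on the restriction of u to [0,L]. *)
definition bvp_solution :: "real \<Rightarrow> (real \<Rightarrow> real) \<Rightarrow> real \<Rightarrow> (real \<Rightarrow> real) \<Rightarrow> bool" where
  "bvp_solution c\<^sub>0 \<zeta> L u \<longleftrightarrow>
     (\<exists>u' u''.
        (\<forall>x\<in>{0..L}. (u has_real_derivative u' x) (at x within {0..L})) \<and>
        continuous_on {0..L} u' \<and>
        (\<forall>x\<in>{0<..<L}. (u' has_real_derivative u'' x) (at x)) \<and>
        continuous_on {0<..<L} u'' \<and>
        (\<forall>x\<in>{0<..<L}. - u'' x + (u x + c\<^sub>0) ^ 3 - (u x + c\<^sub>0) + \<zeta> x = 0) \<and>
        u 0 = 0 \<and> u' L = 0)"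

end

theory Submission
  imports Defs
begin

text \<open>
  Existence: two integrations turn the problem into a fixed point equation on bounded continuous
  functions. Cutting off the nonlinearity at \<open>\<bar>u\<bar> = 1\<close> makes the operator a contraction of the whole
  space for small \<open>L\<close>, and its fixed point is so small that the cutoff is inactive.
  Uniqueness: the difference \<open>w\<close> of two solutions satisfies \<open>w'' = (q - 1) w\<close> with \<open>q \<ge> 0\<close>. Put
  \<open>\<phi> x = cos (L - x)\<close>, a positive solution of \<open>\<phi>'' = - \<phi>\<close>, and let \<open>W = w' \<phi> - w \<phi>'\<close> be the
  Wronskian. Then \<open>((w / \<phi>) W)' = (W / \<phi>)\<^sup>2 + q w\<^sup>2 \<ge> 0\<close>, while \<open>(w / \<phi>) W\<close> vanishes at both ends,
  so \<open>W = 0\<close>; hence \<open>w / \<phi>\<close> is constant, and it vanishes at \<open>0\<close>.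
\<close>

text \<open>Applied to \<open>\<zeta>\<close>, this supplies the continuity under the integrals in
  the existence proof.\<close>

lemma real_analytic_on_imp_continuous_on:
  assumes "real_analytic_on f S"
  shows "continuous_on S f"
proof (intro continuous_at_imp_continuous_on ballI)
  fix x assume "x \<in> S"
  then obtain F where "(\<lambda>h. f (x + h)) has_fps_expansion F"
    using assms by (auto simp: real_analytic_on_def)
  then have "(\<lambda>h. f (x + h)) \<midarrow>0\<rightarrow> f (x + 0)"
    using has_fps_expansion_imp_continuous[where A = UNIV] isCont_def by blast
  then show "isCont f x"
    by (simp add: isCont_iff)
qed

section \<open>Uniqueness via a Wronskian identity\<close>

lemma linear_mixed_bvp_unique:
  fixes w w' q :: "real \<Rightarrow> real"
  assumes L: "0 < L" "L < pi / 2"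
    and w: "\<And>x. x \<in> {0..L} \<Longrightarrow> (w has_real_derivative w' x) (at x within {0..L})"
    and cont': "continuous_on {0..L} w'"
    and w': "\<And>x. x \<in> {0<..<L} \<Longrightarrow> (w' has_real_derivative (q x - 1) * w x) (at x)"
    and q: "\<And>x. x \<in> {0<..<L} \<Longrightarrow> 0 \<le> q x"
    and bc: "w 0 = 0" "w' L = 0"
    and x: "x \<in> {0..L}"
  shows "w x = 0"
proof -
  define \<phi> where "\<phi> = (\<lambda>x. cos (L - x))"
  \<comment> \<open>\<open>sin (L - x)\<close> is \<phi>', so this is the Wronskian of
    \<open>w\<close> and \<open>\<phi>\<close>.\<close>
  define W where "W = (\<lambda>x. w' x * \<phi> x - w x * sin (L - x))"
  define E where "E = (\<lambda>x. w x / \<phi> x * W x)"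
  \<comment> \<open>This is where \<open>L < pi / 2\<close> enters: \<open>L - x\<close> stays in
    [0, pi/2).\<close>
  have pos: "0 < \<phi> x" if "x \<in> {0..L}" for x
    using that L unfolding \<phi>_def by (intro cos_gt_zero_pi) auto
  have cont: "continuous_on {0..L} w"
    using w DERIV_continuous continuous_on_eq_continuous_within by blast
  have cont_z: "continuous_on {0..L} (\<lambda>x. w x / \<phi> x)"
    using pos unfolding \<phi>_def
    by (intro continuous_intros cont) (auto simp: less_imp_neq[symmetric])
  have cont_E: "continuous_on {0..L} E"
    unfolding E_def W_def \<phi>_def
    by (intro continuous_intros cont cont' cont_z[unfolded \<phi>_def])
  have w_at: "(w has_real_derivative w' x) (at x)" if "x \<in> {0<..<L}" for x
    using w[of x] that by (simp add: at_within_Icc_at)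
  have d\<phi>: "(\<phi> has_real_derivative sin (L - x)) (at x)" for x
    unfolding \<phi>_def by (auto intro!: derivative_eq_intros)
  have dz: "((\<lambda>x. w x / \<phi> x) has_real_derivative W x / (\<phi> x)\<^sup>2) (at x)" if "x \<in> {0<..<L}" for x
    using DERIV_divide[OF w_at[OF that] d\<phi>] pos[of x] that
    by (simp add: W_def power2_eq_square)
  \<comment> \<open>In w'' \<phi> - w \<phi>'' the contribution of the -1 in \<open>q x - 1\<close>
    cancels against \<phi>'' = -\<phi>.\<close>
  have dW: "(W has_real_derivative q x * w x * \<phi> x) (at x)" if "x \<in> {0<..<L}" for x
    unfolding W_def
    by (rule derivative_eq_intros w_at[OF that] w'[OF that] d\<phi> refl)+
       (simp add: \<phi>_def algebra_simps)
  have dE: "(E has_real_derivative (W x / \<phi> x)\<^sup>2 + q x * (w x)\<^sup>2) (at x)" if "x \<in> {0<..<L}" for x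
    using DERIV_mult[OF dz[OF that] dW[OF that]] pos[of x] that
    by (simp add: E_def power2_eq_square mult_ac)
  have mono: "E a \<le> E b" if "0 \<le> a" "a \<le> b" "b \<le> L" for a b
  proof (rule DERIV_nonneg_imp_increasing_open[OF that(2)])
    fix y assume y: "a < y" "y < b"
    show "\<exists>d. (E has_real_derivative d) (at y) \<and> 0 \<le> d"
      by (rule exI, rule conjI, rule dE) (use y that q[of y] in auto)
  next
    show "continuous_on {a..b} E"
      using cont_E that by (auto intro: continuous_on_subset)
  qed
  \<comment> \<open>\<open>E 0 = 0\<close> since \<open>w 0 = 0\<close>; \<open>E L = 0\<close>
    since \<open>w' L = 0\<close> and \<open>sin 0 = 0\<close> give \<open>W L = 0\<close>. A
    monotone function with equal end values is constant.\<close>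
  have E0: "E y = 0" if "y \<in> {0..L}" for y
    using mono[of 0 y] mono[of y L] that by (simp add: E_def W_def bc)
  \<comment> \<open>The derivative of \<open>E\<close> is now zero, yet it is a sum of two
    nonnegative terms, so each vanishes.\<close>
  have W0: "W y = 0" if y: "y \<in> {0<..<L}" for y
  proof -
    have "((\<lambda>_. 0) has_real_derivative (W y / \<phi> y)\<^sup>2 + q y * (w y)\<^sup>2) (at y)"
      by (rule has_field_derivative_transform_within_open[OF dE[OF y], of "{0<..<L}"])
         (use y E0 in auto)
    then have "(W y / \<phi> y)\<^sup>2 + q y * (w y)\<^sup>2 = 0"
      using DERIV_unique DERIV_const by blast
    moreover have "0 \<le> q y * (w y)\<^sup>2"
      using q[OF y] by simp
    ultimately have "(W y / \<phi> y)\<^sup>2 = 0"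
      by (smt (verit) zero_le_power2)
    then show ?thesis
      using pos[of y] y by auto
  qed
  have "w x / \<phi> x = w 0 / \<phi> 0"
    by (rule DERIV_isconst2[where f = "\<lambda>x. w x / \<phi> x" and b = L])
       (use L x cont_z dz W0 in force)+
  then show ?thesis
    using pos[OF x] bc by simp
qed

text \<open>Factoring a^3 - b^3 = (a^2 + a b + b^2)(a - b) turns the equation for the difference of
  two solutions into a linear one with a nonnegative coefficient \<open>q\<close>.\<close>

lemma bvp_solution_unique:
  assumes L: "0 < L" "L < pi / 2"
    and u: "bvp_solution c \<zeta> L u" and v: "bvp_solution c \<zeta> L v"
    and x: "x \<in> {0..L}"
  shows "v x = u x"
proof -
  obtain u' u'' where
    u': "\<And>x. x \<in> {0..L} \<Longrightarrow> (u has_real_derivative u' x) (at x within {0..L})"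
      "continuous_on {0..L} u'"
      "\<And>x. x \<in> {0<..<L} \<Longrightarrow> (u' has_real_derivative u'' x) (at x)"
      "\<And>x. x \<in> {0<..<L} \<Longrightarrow> - u'' x + (u x + c) ^ 3 - (u x + c) + \<zeta> x = 0"
      "u 0 = 0" "u' L = 0"
    using u unfolding bvp_solution_def by blast
  obtain v' v'' where
    v': "\<And>x. x \<in> {0..L} \<Longrightarrow> (v has_real_derivative v' x) (at x within {0..L})"
      "continuous_on {0..L} v'"
      "\<And>x. x \<in> {0<..<L} \<Longrightarrow> (v' has_real_derivative v'' x) (at x)"
      "\<And>x. x \<in> {0<..<L} \<Longrightarrow> - v'' x + (v x + c) ^ 3 - (v x + c) + \<zeta> x = 0"
      "v 0 = 0" "v' L = 0"
    using v unfolding bvp_solution_def by blast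
  define q where "q = (\<lambda>x. (v x + c)\<^sup>2 + (v x + c) * (u x + c) + (u x + c)\<^sup>2)"
  \<comment> \<open>Twice \<open>q\<close> is (a + b)^2 + a^2 + b^2 with a = \<open>v x + c\<close>,
    b = \<open>u x + c\<close>.\<close>
  have q: "0 \<le> q x" for x
    unfolding q_def
    using zero_le_power2[of "v x + c + (u x + c)"] zero_le_power2[of "v x + c"]
      zero_le_power2[of "u x + c"]
    unfolding power2_sum by linarith
  have d: "v'' x - u'' x = (q x - 1) * (v x - u x)" if "x \<in> {0<..<L}" for x
    using u'(4)[OF that] v'(4)[OF that] unfolding q_def
    by (simp add: algebra_simps power2_eq_square power3_eq_cube)
  have "v x - u x = 0"
  proof (rule linear_mixed_bvp_unique[OF L, where w = "\<lambda>x. v x - u x" and w' = "\<lambda>x. v' x - u' x" and q = q])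
    show "((\<lambda>x. v' x - u' x) has_real_derivative (q x - 1) * (v x - u x)) (at x)"
      if "x \<in> {0<..<L}" for x
      using d[OF that] DERIV_diff[OF v'(3)[OF that] u'(3)[OF that]] by simp
  qed (use u' v' q x in \<open>auto intro!: derivative_intros continuous_intros\<close>)
  then show ?thesis by simp
qed

section \<open>The integral operator of the linear problem\<close>

text \<open>For continuous \<open>f\<close> this is the solution of y'' = f with y(0) = 0 and y'(L)
  = 0; subtracting the full integral enforces the condition at \<open>L\<close>.\<close>

definition mixed_primitive :: "real \<Rightarrow> (real \<Rightarrow> real) \<Rightarrow> real \<Rightarrow> real" where
  "mixed_primitive L f x = integral {0..x} (\<lambda>s. integral {0..s} f - integral {0..L} f)"

lemma continuous_on_integral_upper:
  fixes f :: "real \<Rightarrow> real"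
  assumes "continuous_on {0..L} f"
  shows "continuous_on {0..L} (\<lambda>s. integral {0..s} f)"
  using assms by (intro indefinite_integral_continuous_1 integrable_continuous_real)

lemma has_derivative_mixed_primitive:
  assumes "continuous_on {0..L} f" "x \<in> {0..L}"
  shows "(mixed_primitive L f has_real_derivative (integral {0..x} f - integral {0..L} f))
           (at x within {0..L})"
  unfolding mixed_primitive_def
  by (rule integral_has_real_derivative[OF _ assms(2)])
     (intro continuous_intros continuous_on_integral_upper assms(1))

lemma continuous_on_mixed_primitive:
  "continuous_on {0..L} f \<Longrightarrow> continuous_on {0..L} (mixed_primitive L f)"
  using has_derivative_mixed_primitive DERIV_continuous continuous_on_eq_continuous_within
  by blast

text \<open>The inner difference is minus the integral of \<open>f\<close> over [s, L], so each of
  the two integrations costs a factor \<open>L\<close>.\<close>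

lemma abs_mixed_primitive_le:
  assumes f: "continuous_on {0..L} f" and B: "\<And>t. t \<in> {0..L} \<Longrightarrow> \<bar>f t\<bar> \<le> B"
    and x: "x \<in> {0..L}"
  shows "\<bar>mixed_primitive L f x\<bar> \<le> B * L\<^sup>2"
proof -
  have B0: "0 \<le> B"
    using B[OF x] by simp
  have inner: "\<bar>integral {0..s} f - integral {0..L} f\<bar> \<le> B * L" if s: "s \<in> {0..L}" for s
  proof -
    have "integral {0..s} f + integral {s..L} f = integral {0..L} f"
      using s f by (intro Henstock_Kurzweil_Integration.integral_combine
          integrable_continuous_real) auto
    moreover have "norm (integral {s..L} f) \<le> B * (L - s)"
      using s B f by (intro integral_bound) (auto intro: continuous_on_subset)
    moreover have "B * (L - s) \<le> B * L"
      using s B0 by (intro mult_left_mono) auto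
    ultimately show ?thesis by simp
  qed
  have "norm (mixed_primitive L f x) \<le> B * L * (x - 0)"
    unfolding mixed_primitive_def
    by (rule integral_bound)
       (use x inner in \<open>auto intro!: continuous_intros continuous_on_subset[OF
           continuous_on_integral_upper[OF f]]\<close>)
  also have "\<dots> \<le> B * L * L"
    using x B0 by (intro mult_left_mono) auto
  finally show ?thesis by (simp add: power2_eq_square mult.assoc)
qed

lemma mixed_primitive_diff:
  assumes f: "continuous_on {0..L} f" and g: "continuous_on {0..L} g" and x: "x \<in> {0..L}"
  shows "mixed_primitive L f x - mixed_primitive L g x = mixed_primitive L (\<lambda>t. f t - g t) x"
proof -
  have int: "(\<lambda>s. integral {0..s} h - integral {0..L} h) integrable_on {0..x}"
    if "continuous_on {0..L} h" for h :: "real \<Rightarrow> real"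
    using x by (intro integrable_continuous_real continuous_intros
        continuous_on_subset[OF continuous_on_integral_upper[OF that]]) auto
  have diff: "integral {0..s} (\<lambda>t. f t - g t) = integral {0..s} f - integral {0..s} g"
    if "s \<in> {0..L}" for s
    using that by (intro integral_diff integrable_continuous_real
        continuous_on_subset[OF f] continuous_on_subset[OF g]) auto
  show ?thesis
    unfolding mixed_primitive_def integral_diff[OF int[OF f] int[OF g], symmetric]
    using x by (intro Henstock_Kurzweil_Integration.integral_cong) (auto simp: diff)
qed

section \<open>Fixed points by contraction\<close>

text \<open>Banach's theorem in the sup metric: the Lipschitz bound of \<open>F\<close> and the
  bound on \<open>mixed_primitive\<close> give the contraction factor
  \<open>K * L\<^sup>2\<close>.\<close>

lemma mixed_fixed_point_exists:
  fixes F :: "real \<Rightarrow> real \<Rightarrow> real"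
  assumes L: "0 \<le> L" and K: "K * L\<^sup>2 < 1"
    and cont: "\<And>u. continuous_on {0..L} u \<Longrightarrow> continuous_on {0..L} (\<lambda>t. F t (u t))"
    and lip: "\<And>t y z. t \<in> {0..L} \<Longrightarrow> \<bar>F t y - F t z\<bar> \<le> K * \<bar>y - z\<bar>"
  obtains u where "continuous_on {0..L} u"
    "\<And>x. x \<in> {0..L} \<Longrightarrow> u x = mixed_primitive L (\<lambda>t. F t (u t)) x"
proof -
  \<comment> \<open>Elements of the function space live on the whole line; \<open>clamp 0 L\<close>
    extends the image constantly beyond [0, L], keeping it bounded and continuous.\<close>
  define T :: "(real \<Rightarrow>\<^sub>C real) \<Rightarrow> (real \<Rightarrow>\<^sub>C real)" where
    "T = (\<lambda>u. Bcontfun (\<lambda>x. mixed_primitive L (\<lambda>t. F t (u t)) (clamp 0 L x)))"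
  have contF: "continuous_on {0..L} (\<lambda>t. F t (apply_bcontfun u t))" for u
    by (intro cont continuous_on_apply_bcontfun)
  have T: "T u x = mixed_primitive L (\<lambda>t. F t (u t)) (clamp 0 L x)" for u x
    unfolding T_def
    using clamp_continuous_on[of 0 L] clamp_bounded
      continuous_on_mixed_primitive[OF contF, of u]
    by (subst Bcontfun_inverse)
       (auto simp: bcontfun_def cbox_interval intro!: clamp_continuous_on clamp_bounded
          compact_imp_bounded[OF compact_continuous_image])
  have clamp: "clamp 0 L x \<in> {0..L}" for x
    using clamp_in_interval[of 0 L x] L by (simp add: cbox_interval)
  have K0: "0 \<le> K"
    using lip[of 0 1 0] L by simp
  have "dist (T u) (T v) \<le> K * L\<^sup>2 * dist u v" for u v
  proof (rule dist_bound)
    fix x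
    have "\<bar>F t (u t) - F t (v t)\<bar> \<le> K * dist u v" if "t \<in> {0..L}" for t
      using lip[OF that, of "u t" "v t"] mult_left_mono[OF dist_bounded[of u t v] K0]
      by (simp add: dist_real_def)
    then show "dist (T u x) (T v x) \<le> K * L\<^sup>2 * dist u v"
      using abs_mixed_primitive_le[OF continuous_on_diff[OF contF contF] _ clamp[of x],
          of u v "K * dist u v"]
      by (simp add: T dist_real_def mixed_primitive_diff[OF contF contF clamp] mult_ac)
  qed
  then obtain u where u: "T u = u"
    using banach_fix_type[of "K * L\<^sup>2" T] K0 K by auto
  have "u x = mixed_primitive L (\<lambda>t. F t (u t)) x" if "x \<in> {0..L}" for x
    using T[of u x] that L by (simp add: u cbox_interval)
  then show thesis
    using that[of "apply_bcontfun u"] continuous_on_apply_bcontfun by blast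
qed

section \<open>Existence through a cutoff nonlinearity\<close>

lemma cubic_lipschitz:
  fixes a b r :: real
  assumes "\<bar>a\<bar> \<le> r" "\<bar>b\<bar> \<le> r"
  shows "\<bar>(a ^ 3 - a) - (b ^ 3 - b)\<bar> \<le> (3 * r\<^sup>2 + 1) * \<bar>a - b\<bar>"
proof -
  have r: "0 \<le> r"
    using assms by linarith
  have "\<bar>a * a\<bar> \<le> r * r" "\<bar>a * b\<bar> \<le> r * r" "\<bar>b * b\<bar> \<le> r * r"
    unfolding abs_mult by (intro mult_mono assms r abs_ge_zero)+
  then have "\<bar>a * a + a * b + b * b - 1\<bar> \<le> 3 * r\<^sup>2 + 1"
    unfolding power2_eq_square by linarith
  moreover have "(a ^ 3 - a) - (b ^ 3 - b) = (a * a + a * b + b * b - 1) * (a - b)"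
    by (simp add: algebra_simps power3_eq_cube)
  ultimately show ?thesis
    by (simp add: abs_mult mult_right_mono)
qed

text \<open>The first smallness condition keeps the fixed point within the cutoff range; the second
  makes the operator a contraction.\<close>

lemma bvp_solution_exists:
  fixes \<zeta> :: "real \<Rightarrow> real"
  assumes \<zeta>: "continuous_on {0..L} \<zeta>" "\<And>x. x \<in> {0..L} \<Longrightarrow> \<bar>\<zeta> x\<bar> \<le> 1"
    and L: "0 \<le> L"
    and r: "r = \<bar>c\<bar> + 1" and small: "(r ^ 3 + r + 1) * L\<^sup>2 \<le> 1" "(3 * r\<^sup>2 + 1) * L\<^sup>2 < 1"
  shows "\<exists>u. bvp_solution c \<zeta> L u"
proof -
  \<comment> \<open>Projection onto [-1, 1]; being 1-Lipschitz, it makes \<open>F\<close> globally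
    Lipschitz in its second argument.\<close>
  define k where "k = (\<lambda>y::real. max (-1) (min 1 y))"
  define F where "F = (\<lambda>t y. (k y + c) ^ 3 - (k y + c) + \<zeta> t)"
  have kr: "\<bar>k y + c\<bar> \<le> r" for y
    unfolding k_def r by auto
  have contF: "continuous_on {0..L} (\<lambda>t. F t (u t))" if "continuous_on {0..L} u" for u
    unfolding F_def k_def by (intro continuous_intros that \<zeta>(1))
  have lipF: "\<bar>F t y - F t z\<bar> \<le> (3 * r\<^sup>2 + 1) * \<bar>y - z\<bar>" for t y z
  proof -
    have "\<bar>F t y - F t z\<bar> \<le> (3 * r\<^sup>2 + 1) * \<bar>k y - k z\<bar>"
      using cubic_lipschitz[OF kr[of y] kr[of z]] by (simp add: F_def)
    also have "\<dots> \<le> (3 * r\<^sup>2 + 1) * \<bar>y - z\<bar>"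
      by (intro mult_left_mono) (auto simp: k_def)
    finally show ?thesis .
  qed
  obtain u where cu: "continuous_on {0..L} u"
    and u: "\<And>x. x \<in> {0..L} \<Longrightarrow> u x = mixed_primitive L (\<lambda>t. F t (u t)) x"
    using mixed_fixed_point_exists[where F = F, OF L small(2) contF lipF] by blast
  define f where "f = (\<lambda>t. F t (u t))"
  have cf: "continuous_on {0..L} f"
    unfolding f_def by (rule contF[OF cu])
  have "\<bar>f t\<bar> \<le> r ^ 3 + r + 1" if "t \<in> {0..L}" for t
  proof -
    have "\<bar>(k (u t) + c) ^ 3\<bar> \<le> r ^ 3"
      unfolding power_abs by (intro power_mono kr) auto
    then show ?thesis
      using \<zeta>(2)[OF that] kr[of "u t"] unfolding f_def F_def by linarith
  qed
  \<comment> \<open>The bound on \<open>f\<close> times \<open>L\<^sup>2\<close> is at most 1, so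
    \<open>k (u x) = u x\<close> and \<open>f\<close> is the original nonlinearity.\<close>
  then have "\<bar>u x\<bar> \<le> 1" if "x \<in> {0..L}" for x
    using abs_mixed_primitive_le[OF cf _ that] small(1) u[OF that] unfolding f_def
    by (metis order_trans)
  then have f: "f x = (u x + c) ^ 3 - (u x + c) + \<zeta> x" if "x \<in> {0..L}" for x
    using that unfolding f_def F_def k_def by (fastforce simp: abs_le_iff)
  define u' where "u' = (\<lambda>x. integral {0..x} f - integral {0..L} f)"
  have d: "(u has_real_derivative u' x) (at x within {0..L})" if "x \<in> {0..L}" for x
    using has_derivative_mixed_primitive[OF cf that] unfolding u'_def
    by (rule has_field_derivative_transform_within[OF _ zero_less_one that])
       (use u in \<open>simp add: f_def\<close>)
  have d': "(u' has_real_derivative f x) (at x)" if "x \<in> {0<..<L}" for x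
  proof -
    have "(u' has_real_derivative f x) (at x within {0..L})"
      unfolding u'_def using that
      by (auto intro!: derivative_eq_intros integral_has_real_derivative[OF cf])
    then show ?thesis
      using that by (simp add: at_within_Icc_at)
  qed
  show ?thesis
    unfolding bvp_solution_def
  proof (intro exI conjI ballI)
    show "continuous_on {0..L} u'"
      unfolding u'_def by (intro continuous_intros continuous_on_integral_upper cf)
    show "continuous_on {0<..<L} f"
      using cf by (rule continuous_on_subset) auto
    show "u 0 = 0"
      using u[of 0] L by (simp add: mixed_primitive_def)
  qed (use d d' f in \<open>auto simp: u'_def\<close>)
qed

theorem proposition2p6:
  fixes c\<^sub>0 :: real and \<zeta> :: "real \<Rightarrow> real" and I :: "real set"
  assumes "open I" and "is_interval I" and "{0..} \<subseteq> I"
    and "real_analytic_on \<zeta> I"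
    and "\<And>x. x \<in> I \<Longrightarrow> \<zeta> x \<in> {-1<..<0}"
  shows "\<exists>\<Lambda>\<^sub>0>0. \<forall>L\<in>{0<..<\<Lambda>\<^sub>0}.
           \<exists>u. bvp_solution c\<^sub>0 \<zeta> L u \<and>
               (\<forall>v. bvp_solution c\<^sub>0 \<zeta> L v \<longrightarrow> (\<forall>x\<in>{0..L}. v x = u x))"
proof -
  define r where "r = \<bar>c\<^sub>0\<bar> + 1"
  \<comment> \<open>The sum of both constants, so \<open>A * L\<^sup>2 < 1\<close> yields both
    smallness conditions. As \<open>A > 1\<close>, \<open>L < 1 / A\<close> also gives
    \<open>L < 1\<close>, hence \<open>L\<^sup>2 \<le> L\<close> and
    \<open>L < pi / 2\<close>.\<close>
  define A where "A = (r ^ 3 + r + 1) + (3 * r\<^sup>2 + 1)"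
  have r: "0 < r"
    unfolding r_def by simp
  have A: "1 < A"
    unfolding A_def using r by (simp add: add_pos_pos)
  show ?thesis
  proof (intro exI[of _ "1 / A"] conjI ballI)
    show "0 < 1 / A"
      using A by simp
  next
    fix L assume "L \<in> {0<..<1 / A}"
    then have L: "0 < L" "A * L < 1"
      using A by (auto simp: field_simps)
    have "1 * L \<le> A * L"
      using A L by (intro mult_right_mono) auto
    then have L1: "L < 1"
      using L by linarith
    have "A * L\<^sup>2 \<le> A * L"
      using A L L1 by (simp add: power2_eq_square)
    then have AL: "A * L\<^sup>2 < 1"
      using L by simp
    have "(r ^ 3 + r + 1) * L\<^sup>2 \<le> A * L\<^sup>2" "(3 * r\<^sup>2 + 1) * L\<^sup>2 \<le> A * L\<^sup>2"
      unfolding A_def using r by (auto intro!: mult_right_mono)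
    then have small: "(r ^ 3 + r + 1) * L\<^sup>2 \<le> 1" "(3 * r\<^sup>2 + 1) * L\<^sup>2 < 1"
      using AL by linarith+
    have sub: "{0..L} \<subseteq> I"
      using assms(3) by auto
    have "continuous_on {0..L} \<zeta>"
      using real_analytic_on_imp_continuous_on[OF assms(4)] sub by (rule continuous_on_subset)
    moreover have "\<bar>\<zeta> x\<bar> \<le> 1" if "x \<in> {0..L}" for x
      using assms(5)[of x] sub that by auto
    ultimately obtain u where u: "bvp_solution c\<^sub>0 \<zeta> L u"
      using bvp_solution_exists[OF _ _ _ r_def small] L by auto
    have "L < pi / 2"
      using L1 pi_gt3 by simp
    then show "\<exists>u. bvp_solution c\<^sub>0 \<zeta> L u \<and>
        (\<forall>v. bvp_solution c\<^sub>0 \<zeta> L v \<longrightarrow> (\<forall>x\<in>{0..L}. v x = u x))"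
      using u bvp_solution_unique[OF L(1)] by blast
  qed
qed

end
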